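(* Let $f:\{0,1\}\times[0,T]\to\mathbb{R}^2$ be a one-strip semi-discrete framework with no boundary forces ($\mu_{-1}=\mu_1=0$). Then $f$ is liftable if and only if, for all $t\in[0,T]$, $$[\dot f_0,\ddot f_0]\,[\dot f_1,\ddot f_1]\Big([\Delta f_0,\dot f_0]\big(2[\Delta f_0,\ddot f_1]-[\dot f_0,\dot f_1]\big)-[\Delta f_0,\dot f_1]\big(2[\Delta f_0,\ddot f_0]-[\dot f_0,\dot f_1]\big)\Big)$$ $$=[\Delta f_0,\dot f_0]\,[\Delta f_0,\dot f_1]\Big([\dot f_0,\ddot f_0]\,[\dot f_1,\dddot f_1]-[\dot f_1,\ddot f_1]\,[\dot f_0,\dddot f_0]\Big).$$
   Context: Let $T>0$. A one-strip framework consists of two smooth curves $f_0,f_1:[0,T]\to\mathbb{R}^2$, $f_i(t)=f(i,t)$. Dots denote derivatives in $t$, $\Delta f_0=f_1-f_0$, and $[a,b]=\det(a,b)$ is the determinant of the $2\times 2$ matrix with columns $a,b\in\mathbb{R}^2$. The framework is assumed regular: for every $t$ the pairs $(\dot f_0(t),\Delta f_0(t))$ and $(\dot f_1(t),\Delta f_0(t))$ are linearly independent. In general a stress $(\lambda,\mu)$ on a framework is a self-stress if $\dot\lambda_i\dot f_i+\lambda_i\ddot f_i+\mu_i\Delta f_i-\mu_{i-1}\Delta f_{i-1}=0$ for all $i,t$, and liftability of a framework is equivalent to the existence of a self-stress. For the one-strip framework with no boundary forces ($\mu_{-1}=\mu_1=0$), "liftable" means that there exist functions $\lambda_0,\lambda_1,\mu_0:[0,T]\to\mathbb{R}$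 ($\lambda_0,\lambda_1$ continuously differentiable, $\mu_0$ continuous), not all identically zero, with $$\dot\lambda_0\dot f_0+\lambda_0\ddot f_0+\mu_0\Delta f_0=0,\qquad \dot\lambda_1\dot f_1+\lambda_1\ddot f_1-\mu_0\Delta f_0=0\quad\text{on }[0,T].$$
   Formalization: The identity implies liftability only under an added assumption: the points where both [f_0',f_0''] and [f_1',f_1''] vanish to infinite order do not disconnect [0,T]; without it smooth counterexamples exist. Liftable implies the identity with no extra assumption. *)

theory Defs
  imports "HOL-Analysis.Analysis"
begin

text \<open>The determinant of the \<open>2 \<times> 2\<close> matrix with columns \<open>a\<close> and \<open>b\<close>.\<close>

definition bracket :: "real^2 \<Rightarrow> real^2 \<Rightarrow> real" where
  "bracket a b = det ((\<chi> i j. if j = 1 then a $ i else b $ i) :: real^2^2)"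

lemma bracket_eq: "bracket a b = a $ 1 * b $ 2 - b $ 1 * a $ 2"
  by (simp add: bracket_def det_2)

text \<open>Iterated derivatives relative to a set of parameters. On \<open>{0..T}\<close> these are the usual
  derivatives in the interior and one-sided derivatives at the end points; values of a curve
  outside \<open>{0..T}\<close> play no role.\<close>

definition nderiv :: "real set \<Rightarrow> nat \<Rightarrow> (real \<Rightarrow> 'a::real_normed_vector) \<Rightarrow> real \<Rightarrow> 'a" where
  "nderiv S k g = ((\<lambda>h t. vector_derivative h (at t within S)) ^^ k) g"

definition smooth_on :: "real set \<Rightarrow> (real \<Rightarrow> 'a::real_normed_vector) \<Rightarrow> bool" where
  "smooth_on S g \<longleftrightarrow> (\<forall>k. \<forall>t\<in>S. nderiv S k g differentiable (at t within S))"

definition C1_on :: "real set \<Rightarrow> (real \<Rightarrow> 'a::real_normed_vector) \<Rightarrow> bool" where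
  "C1_on S g \<longleftrightarrow> (\<forall>t\<in>S. g differentiable (at t within S)) \<and> continuous_on S (nderiv S 1 g)"

text \<open>Linear independence of a pair, as opposed to that of the set \<open>{a, b}\<close>, which
  collapses when \<open>a = b\<close>.\<close>

definition lin_indep_pair :: "real^2 \<Rightarrow> real^2 \<Rightarrow> bool" where
  "lin_indep_pair a b \<longleftrightarrow> a \<noteq> b \<and> independent {a, b}"

definition strip_diff :: "(nat \<Rightarrow> real \<Rightarrow> real^2) \<Rightarrow> real \<Rightarrow> real^2" where
  "strip_diff f t = f 1 t - f 0 t"

text \<open>Only the curves \<open>f 0\<close> and \<open>f 1\<close> belong to the framework.\<close>

definition one_strip_framework :: "real \<Rightarrow> (nat \<Rightarrow> real \<Rightarrow> real^2) \<Rightarrow> bool" where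
  "one_strip_framework T f \<longleftrightarrow>
     smooth_on {0..T} (f 0) \<and> smooth_on {0..T} (f 1) \<and>
     (\<forall>t\<in>{0..T}. lin_indep_pair (nderiv {0..T} 1 (f 0) t) (strip_diff f t) \<and>
                  lin_indep_pair (nderiv {0..T} 1 (f 1) t) (strip_diff f t))"

text \<open>Existence of a nonzero self-stress \<open>(\<lambda>, \<mu>)\<close> with vanishing boundary forces
  \<open>\<mu>\<^sub>-\<^sub>1 = \<mu>\<^sub>1 = 0\<close>.\<close>

definition liftable :: "real \<Rightarrow> (nat \<Rightarrow> real \<Rightarrow> real^2) \<Rightarrow> bool" where
  "liftable T f \<longleftrightarrow>
     (\<exists>l0 l1 m0 :: real \<Rightarrow> real.
        C1_on {0..T} l0 \<and> C1_on {0..T} l1 \<and> continuous_on {0..T} m0 \<and>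
        (\<exists>t\<in>{0..T}. l0 t \<noteq> 0 \<or> l1 t \<noteq> 0 \<or> m0 t \<noteq> 0) \<and>
        (\<forall>t\<in>{0..T}.
           nderiv {0..T} 1 l0 t *\<^sub>R nderiv {0..T} 1 (f 0) t + l0 t *\<^sub>R nderiv {0..T} 2 (f 0) t
             + m0 t *\<^sub>R strip_diff f t = 0 \<and>
           nderiv {0..T} 1 l1 t *\<^sub>R nderiv {0..T} 1 (f 1) t + l1 t *\<^sub>R nderiv {0..T} 2 (f 1) t
             - m0 t *\<^sub>R strip_diff f t = 0))"

text \<open>\<open>inflection f\<^sub>i = [f\<^sub>i', f\<^sub>i'']\<close> vanishes exactly at the inflection parameters of
  the \<open>i\<close>-th curve.\<close>

definition inflection :: "real \<Rightarrow> (real \<Rightarrow> real^2) \<Rightarrow> real \<Rightarrow> real" where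
  "inflection T g t = bracket (nderiv {0..T} 1 g t) (nderiv {0..T} 2 g t)"

text \<open>The parameters at which both curves have an inflection of infinite order do not
  disconnect the parameter interval. This holds in particular if the curves have no common
  inflection, if all common inflections have finite order, if both curves are real analytic, or
  if both are straight. Without it the closed condition on the framework is
  not sufficient for liftability: let
  \<open>f 0 t = (t, e * p t)\<close> and \<open>f 1 t = (t, 1 + e * q t)\<close> with \<open>e > 0\<close> small and \<open>p\<close>, \<open>q\<close> nonzero
  smooth bumps with compact support in \<open>{0<..<T/2}\<close> and \<open>{T/2<..<T}\<close>. All terms of the condition
  vanish since \<open>p''\<close> and \<open>q''\<close> have disjoint supports, whereas the first coordinates of the
  self-stress equations force \<open>l0\<close>, \<open>l1\<close> to be constant and the sum of the second coordinates
  reads \<open>l0 * p'' + l1 * q'' = 0\<close>, so that only the zero stress remains.\<close>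

definition flat_inflections_nonseparating :: "real \<Rightarrow> (nat \<Rightarrow> real \<Rightarrow> real^2) \<Rightarrow> bool" where
  "flat_inflections_nonseparating T f \<longleftrightarrow>
     connected {t\<in>{0..T}. \<exists>k. nderiv {0..T} k (inflection T (f 0)) t \<noteq> 0 \<or>
                               nderiv {0..T} k (inflection T (f 1)) t \<noteq> 0}"

end

theory Submission
  imports Defs
begin

text \<open>
  Let \<open>\<alpha>\<^sub>i = [\<Delta>, f\<^sub>i']\<close>, \<open>c\<^sub>i = [\<Delta>, f\<^sub>i'']\<close>, \<open>g\<^sub>i = [f\<^sub>i', f\<^sub>i'']\<close> and \<open>w = [f\<^sub>0', f\<^sub>1']\<close>;
  regularity says that \<open>\<alpha>\<^sub>0\<close> and \<open>\<alpha>\<^sub>1\<close> have no zero. Since \<open>\<Delta>\<close> and \<open>f\<^sub>i'\<close> form a basis, the stress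
  equation of the \<open>i\<close>-th curve is equivalent to its brackets with these two vectors. The bracket
  with \<open>\<Delta>\<close> eliminates \<open>\<mu>\<^sub>0\<close> and leaves the linear equation \<open>\<lambda>\<^sub>i' \<alpha>\<^sub>i + \<lambda>\<^sub>i c\<^sub>i = 0\<close>, so
  \<open>\<lambda>\<^sub>i = C\<^sub>i E\<^sub>i\<close> with the positive function \<open>E\<^sub>i = exp (- \<integral> c\<^sub>i / \<alpha>\<^sub>i)\<close> and a constant \<open>C\<^sub>i\<close>.
  The bracket with \<open>f\<^sub>i'\<close> gives \<open>\<mu>\<^sub>0 = C\<^sub>0 u\<^sub>0\<close> and \<open>- \<mu>\<^sub>0 = C\<^sub>1 u\<^sub>1\<close> for
  \<open>u\<^sub>i = E\<^sub>i g\<^sub>i / \<alpha>\<^sub>i\<close>. A nonzero self-stress therefore exists iff \<open>u\<^sub>0\<close> and \<open>u\<^sub>1\<close> are linearly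
  dependent on \<open>[0, T]\<close> (\<open>liftable_iff_dependent\<close>). Because \<open>\<alpha>\<^sub>i' = c\<^sub>i - w\<close> for both curves,
  the Wronskian of \<open>u\<^sub>0\<close> and \<open>u\<^sub>1\<close> is, up to the nowhere vanishing factor
  \<open>E\<^sub>0 E\<^sub>1 / (\<alpha>\<^sub>0 \<alpha>\<^sub>1)\<^sup>2\<close>, the difference of the two sides of the condition
  (\<open>wronskian_zero_iff\<close>). This proves that the condition is necessary.

  A vanishing Wronskian forces dependence on every interval on which \<open>(u\<^sub>0, u\<^sub>1)\<close> has no zero
  (\<open>wronskian_zero_imp_parallel\<close>), but in general not across a common zero. At a common zero \<open>t\<^sub>0\<close> of finite order \<open>k\<close> the quotient
  \<open>(u\<^sub>0, u\<^sub>1) / (t - t\<^sub>0)\<^sup>k\<close> has a nonzero limit by Taylor's formula. The zero is then isolated, and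
  the direction on either side of it is that of the limit, hence the same on both sides
  (\<open>wronskian_zero_direction_at\<close>). So the direction is locally constant on the set of
  parameters that are not common inflections of infinite order. If that set is connected, the
  direction is constant, and at the remaining parameters both \<open>u\<^sub>i\<close> vanish
  (\<open>wronskian_zero_imp_dependent\<close>).
\<close>

section \<open>Iterated derivatives on a closed interval\<close>

lemma nderiv_0 [simp]: "nderiv S 0 g = g"
  by (simp add: nderiv_def)

lemma nderiv_Suc: "nderiv S (Suc k) g t = vector_derivative (nderiv S k g) (at t within S)"
  by (simp add: nderiv_def)

lemma nderiv_Suc_shift: "nderiv S (Suc k) g = nderiv S k (nderiv S 1 g)"
  by (induction k) (auto simp: nderiv_def)

lemma nderiv_1_eqI:
  fixes g :: "real \<Rightarrow> 'a::euclidean_space"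
  assumes "a < b" "t \<in> {a..b}" "(g has_vector_derivative g') (at t within {a..b})"
  shows "nderiv {a..b} 1 g t = g'"
  using vector_derivative_within_closed_interval[OF assms] by (simp add: nderiv_Suc)

lemma nderiv_cong:
  assumes "\<And>t. t \<in> S \<Longrightarrow> g t = h t" "t \<in> S"
  shows "nderiv S k g t = nderiv S k h t"
  using assms(2)
proof (induction k arbitrary: t)
  case 0
  then show ?case using assms by simp
next
  case (Suc k)
  have "(nderiv S k g has_vector_derivative d) (at t within S) \<longleftrightarrow>
      (nderiv S k h has_vector_derivative d) (at t within S)" for d
    using Suc by (intro iffI) (rule has_vector_derivative_transform; simp)+
  then show ?case by (simp add: nderiv_Suc vector_derivative_def)
qed

lemma smooth_on_nderiv_deriv:
  assumes "smooth_on S g" "t \<in> S"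
  shows "(nderiv S k g has_vector_derivative nderiv S (Suc k) g t) (at t within S)"
  using assms by (simp add: smooth_on_def nderiv_Suc vector_derivative_works)

lemma smooth_on_nderiv_continuous:
  "smooth_on S g \<Longrightarrow> continuous_on S (nderiv S k g)"
  using smooth_on_nderiv_deriv has_vector_derivative_continuous continuous_on_eq_continuous_within
  by blast

text \<open>A finite-order version of \<^const>\<open>smooth_on\<close>, on which closure under products can be
  proved by induction: differentiating a product lowers the order by one and
  leaves a sum of products, so no explicit Leibniz formula for higher derivatives is needed.\<close>

definition times_differentiable_on :: "nat \<Rightarrow> real set \<Rightarrow> (real \<Rightarrow> 'a::real_normed_vector) \<Rightarrow> bool"
  where "times_differentiable_on n S g \<longleftrightarrow>
    (\<forall>k<n. \<forall>t\<in>S. nderiv S k g differentiable (at t within S))"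

lemma smooth_on_iff_times_differentiable:
  "smooth_on S g \<longleftrightarrow> (\<forall>n. times_differentiable_on n S g)"
  by (auto simp: smooth_on_def times_differentiable_on_def)

lemma times_differentiable_on_mono:
  "times_differentiable_on n S g \<Longrightarrow> m \<le> n \<Longrightarrow> times_differentiable_on m S g"
  by (auto simp: times_differentiable_on_def)

lemma times_differentiable_on_SucD:
  assumes "times_differentiable_on (Suc n) S g"
  shows "\<And>t. t \<in> S \<Longrightarrow> (g has_vector_derivative nderiv S 1 g t) (at t within S)"
    and "times_differentiable_on n S (nderiv S 1 g)"
proof -
  fix t assume "t \<in> S"
  then have "nderiv S 0 g differentiable (at t within S)"
    using assms by (auto simp only: times_differentiable_on_def)
  then show "(g has_vector_derivative nderiv S 1 g t) (at t within S)"
    by (simp add: nderiv_Suc vector_derivative_works)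
next
  show "times_differentiable_on n S (nderiv S 1 g)"
    unfolding times_differentiable_on_def nderiv_Suc_shift[symmetric]
    using assms by (auto simp: times_differentiable_on_def)
qed

text \<open>On a nondegenerate interval derivatives are unique, so any function known to be the
  derivative may replace the first iterated one, although the two may differ outside the interval.\<close>

lemma times_differentiable_on_SucI:
  fixes g :: "real \<Rightarrow> 'a::euclidean_space"
  assumes "a < b"
    and g: "\<And>t. t \<in> {a..b} \<Longrightarrow> (g has_vector_derivative g' t) (at t within {a..b})"
    and g': "times_differentiable_on n {a..b} g'"
  shows "times_differentiable_on (Suc n) {a..b} g"
  unfolding times_differentiable_on_def
proof (intro allI impI ballI)
  fix k t assume k: "k < Suc n" and t: "t \<in> {a..b}"
  show "nderiv {a..b} k g differentiable (at t within {a..b})"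
  proof (cases k)
    case 0
    then show ?thesis using g[OF t] by (auto intro: differentiableI_vector)
  next
    case (Suc j)
    have "(nderiv {a..b} j g' has_vector_derivative nderiv {a..b} (Suc j) g' t) (at t within {a..b})"
      using g' k t Suc by (simp add: times_differentiable_on_def nderiv_Suc vector_derivative_works)
    moreover have "nderiv {a..b} (Suc j) g s = nderiv {a..b} j g' s" if "s \<in> {a..b}" for s
      unfolding nderiv_Suc_shift
      by (rule nderiv_cong[OF _ that]) (rule nderiv_1_eqI[OF assms(1) _ g])
    ultimately show ?thesis
      unfolding Suc using t
      by (intro differentiableI_vector) (rule has_vector_derivative_transform)
  qed
qed

lemma times_differentiable_on_add:
  fixes g h :: "real \<Rightarrow> 'a::euclidean_space"
  assumes "a < b" "times_differentiable_on n {a..b} g" "times_differentiable_on n {a..b} h"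
  shows "times_differentiable_on n {a..b} (\<lambda>t. g t + h t)"
  using assms(2,3)
proof (induction n arbitrary: g h)
  case 0
  then show ?case by (simp add: times_differentiable_on_def)
next
  case (Suc n)
  note g = times_differentiable_on_SucD[OF Suc.prems(1)]
  note h = times_differentiable_on_SucD[OF Suc.prems(2)]
  show ?case
    by (rule times_differentiable_on_SucI[OF \<open>a < b\<close> has_vector_derivative_add[OF g(1) h(1)]
          Suc.IH[OF g(2) h(2)]])
qed

lemma times_differentiable_on_bilinear:
  fixes g :: "real \<Rightarrow> 'a::euclidean_space" and h :: "real \<Rightarrow> 'b::euclidean_space"
    and B :: "'a \<Rightarrow> 'b \<Rightarrow> 'c::euclidean_space"
  assumes "bounded_bilinear B" "a < b"
    and "times_differentiable_on n {a..b} g" "times_differentiable_on n {a..b} h"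
  shows "times_differentiable_on n {a..b} (\<lambda>t. B (g t) (h t))"
  using assms(3,4)
proof (induction n arbitrary: g h)
  case 0
  then show ?case by (simp add: times_differentiable_on_def)
next
  case (Suc n)
  note g = times_differentiable_on_SucD[OF Suc.prems(1)]
  note h = times_differentiable_on_SucD[OF Suc.prems(2)]
  have gn: "times_differentiable_on n {a..b} g" and hn: "times_differentiable_on n {a..b} h"
    using Suc.prems times_differentiable_on_mono by (blast intro: le_SucI)+
  show ?case
  proof (rule times_differentiable_on_SucI[OF \<open>a < b\<close>])
    show "((\<lambda>t. B (g t) (h t)) has_vector_derivative
        B (g t) (nderiv {a..b} 1 h t) + B (nderiv {a..b} 1 g t) (h t)) (at t within {a..b})"
      if "t \<in> {a..b}" for t
      using bounded_bilinear.has_vector_derivative[OF assms(1)] g(1) h(1) that by blast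
    show "times_differentiable_on n {a..b}
        (\<lambda>t. B (g t) (nderiv {a..b} 1 h t) + B (nderiv {a..b} 1 g t) (h t))"
      by (rule times_differentiable_on_add[OF \<open>a < b\<close> Suc.IH[OF gn h(2)] Suc.IH[OF g(2) hn]])
  qed
qed

lemma smooth_on_bilinear:
  fixes g :: "real \<Rightarrow> 'a::euclidean_space" and h :: "real \<Rightarrow> 'b::euclidean_space"
    and B :: "'a \<Rightarrow> 'b \<Rightarrow> 'c::euclidean_space"
  assumes "bounded_bilinear B" "a < b" "smooth_on {a..b} g" "smooth_on {a..b} h"
  shows "smooth_on {a..b} (\<lambda>t. B (g t) (h t))"
  using assms times_differentiable_on_bilinear unfolding smooth_on_iff_times_differentiable by blast

lemma smooth_on_nderiv_smooth:
  assumes "smooth_on S g"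
  shows "smooth_on S (nderiv S k g)"
proof -
  have "nderiv S j (nderiv S k g) = nderiv S (j + k) g" for j
    by (simp add: nderiv_def funpow_add)
  then show ?thesis using assms by (simp add: smooth_on_def)
qed

text \<open>Taylor's formula with a remainder of order \<open>k + 1\<close>. For the least \<open>k\<close> with nonzero derivative
  the limit is nonzero, so that \<open>g\<close> has no other zero near \<open>t0\<close>.\<close>

lemma taylor_leading_term:
  fixes g :: "real \<Rightarrow> real"
  assumes g: "smooth_on {a..b} g" and t0: "t0 \<in> {a..b}"
    and low: "\<And>j. j < k \<Longrightarrow> nderiv {a..b} j g t0 = 0"
  shows "((\<lambda>t. g t / (t - t0) ^ k) \<longlongrightarrow> nderiv {a..b} k g t0 / fact k) (at t0 within {a..b})"
proof -
  have "compact (nderiv {a..b} (Suc k) g ` {a..b})"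
    using smooth_on_nderiv_continuous[OF g] by (intro compact_continuous_image) auto
  then obtain M where M: "\<And>t. t \<in> {a..b} \<Longrightarrow> norm (nderiv {a..b} (Suc k) g t) \<le> M"
    by (meson bounded_iff compact_imp_bounded imageI)
  have bound: "\<bar>g t - nderiv {a..b} k g t0 * (t - t0) ^ k / fact k\<bar> \<le> M * \<bar>t - t0\<bar> ^ Suc k / fact k"
    if t: "t \<in> {a..b}" for t
  proof -
    have "(\<Sum>i\<le>k. nderiv {a..b} i g t0 * (t - t0) ^ i / fact i)
        = nderiv {a..b} k g t0 * (t - t0) ^ k / fact k"
      by (subst sum.remove[of _ k]) (auto intro!: sum.neutral simp: low)
    then show ?thesis
      using field_Taylor[of "{a..b}" k "\<lambda>i. nderiv {a..b} i g" M t0 t] M t0 t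
        smooth_on_nderiv_deriv[OF g]
      by (simp add: has_real_derivative_iff_has_vector_derivative)
  qed
  have est: "\<bar>g t / (t - t0) ^ k - nderiv {a..b} k g t0 / fact k\<bar> \<le> M / fact k * \<bar>t - t0\<bar>"
    if t: "t \<in> {a..b}" "t \<noteq> t0" for t
  proof -
    have "\<bar>g t / (t - t0) ^ k - nderiv {a..b} k g t0 / fact k\<bar>
        = \<bar>g t - nderiv {a..b} k g t0 * (t - t0) ^ k / fact k\<bar> / \<bar>t - t0\<bar> ^ k"
      using t by (simp add: divide_simps mult.commute flip: power_abs abs_divide)
    also have "\<dots> \<le> (M * \<bar>t - t0\<bar> ^ Suc k / fact k) / \<bar>t - t0\<bar> ^ k"
      using bound[OF t(1)] by (intro divide_right_mono) auto
    also have "\<dots> = M / fact k * \<bar>t - t0\<bar>" using t by simp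
    finally show ?thesis .
  qed
  have "((\<lambda>t. M / fact k * \<bar>t - t0\<bar>) \<longlongrightarrow> 0) (at t0 within {a..b})"
    by (auto intro!: tendsto_eq_intros)
  then have "((\<lambda>t. g t / (t - t0) ^ k - nderiv {a..b} k g t0 / fact k) \<longlongrightarrow> 0) (at t0 within {a..b})"
    by (rule Lim_null_comparison[rotated])
       (unfold eventually_at_filter real_norm_def, rule always_eventually, use est in blast)
  then show ?thesis by (rule LIM_zero_cancel)
qed

section \<open>Curves in the plane with vanishing Wronskian\<close>

text \<open>If \<open>z\<close> is the determinant of the fixed vector \<open>(u s, v s)\<close> with the moving one and \<open>N\<close> is
  the squared length of the latter, then \<open>z\<^sup>2 / N\<close>, which is up to a constant factor the squared
  sine of the angle between them, has derivative zero; it vanishes at \<open>s\<close>.\<close>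

lemma wronskian_zero_imp_parallel:
  fixes u v u' v' :: "real \<Rightarrow> real"
  assumes J: "convex J" "s \<in> J" "t \<in> J"
    and u: "\<And>x. x \<in> J \<Longrightarrow> (u has_field_derivative u' x) (at x within J)"
    and v: "\<And>x. x \<in> J \<Longrightarrow> (v has_field_derivative v' x) (at x within J)"
    and W: "\<And>x. x \<in> J \<Longrightarrow> u x * v' x = u' x * v x"
    and nz: "\<And>x. x \<in> J \<Longrightarrow> u x \<noteq> 0 \<or> v x \<noteq> 0"
  shows "u s * v t = v s * u t"
proof -
  define z where "z = (\<lambda>x. u s * v x - v s * u x)"
  define N where "N = (\<lambda>x. u x ^ 2 + v x ^ 2)"
  have N: "N x \<noteq> 0" if "x \<in> J" for x
    using nz[OF that] by (simp add: N_def sum_power2_eq_zero_iff)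
  have "((\<lambda>x. z x ^ 2 / N x) has_field_derivative 0) (at x within J)" if x: "x \<in> J" for x
  proof -
    define A where "A = u s * v' x - v s * u' x"
    define B where "B = u x * u' x + v x * v' x"
    have dz: "(z has_field_derivative A) (at x within J)"
      unfolding z_def A_def by (auto intro!: derivative_eq_intros u v x)
    have dN: "(N has_field_derivative 2 * B) (at x within J)"
      unfolding N_def B_def by (auto intro!: derivative_eq_intros u v x)
    \<comment> \<open>The numerator of the derivative of \<open>z\<^sup>2 / N\<close> is \<open>2 z (A N - z B)\<close>, a multiple of the Wronskian.\<close>
    have "A * N x - z x * B = (u s * u x + v s * v x) * (u x * v' x - u' x * v x)"
      unfolding A_def B_def z_def N_def by (simp add: power2_eq_square algebra_simps)
    also have "\<dots> = 0" using W[OF x] by simp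
    finally have "A * N x = z x * B" by simp
    then have num: "z x * (2 * A) * N x = z x ^ 2 * (2 * B)"
      by (simp add: power2_eq_square mult_ac)
    have "((\<lambda>x. z x ^ 2) has_field_derivative z x * (2 * A)) (at x within J)"
      by (auto intro!: derivative_eq_intros dz)
    from DERIV_divide[OF this dN N[OF x]] show ?thesis
      using num by simp
  qed
  then obtain c where c: "\<And>x. x \<in> J \<Longrightarrow> z x ^ 2 / N x = c"
    using has_field_derivative_zero_constant[OF J(1), of "\<lambda>x. z x ^ 2 / N x"] by blast
  have "z s = 0" by (simp add: z_def)
  then have "z t ^ 2 / N t = 0" using c[OF J(2)] c[OF J(3)] by simp
  then show ?thesis using N[OF J(3)] by (simp add: z_def)
qed

text \<open>On each side of \<open>t0\<close> the vectors \<open>(u s, v s)\<close> and \<open>(u t, v t)\<close> are parallel. Dividing the first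
  by \<open>(s - t0) ^ k\<close> and letting \<open>s\<close> tend to \<open>t0\<close> shows that \<open>(u t, v t)\<close> is parallel to \<open>(p, q)\<close>,
  which does not depend on the side.\<close>

lemma wronskian_zero_direction_at:
  fixes u v u' v' :: "real \<Rightarrow> real"
  assumes t0: "t0 \<in> {a..b}"
    and u: "\<And>x. x \<in> {a..b} \<Longrightarrow> (u has_field_derivative u' x) (at x within {a..b})"
    and v: "\<And>x. x \<in> {a..b} \<Longrightarrow> (v has_field_derivative v' x) (at x within {a..b})"
    and W: "\<And>x. x \<in> {a..b} \<Longrightarrow> u x * v' x = u' x * v x"
    and p: "((\<lambda>t. u t / (t - t0) ^ k) \<longlongrightarrow> p) (at t0 within {a..b})"
    and q: "((\<lambda>t. v t / (t - t0) ^ k) \<longlongrightarrow> q) (at t0 within {a..b})"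
    and pq: "p \<noteq> 0 \<or> q \<noteq> 0"
  shows "\<forall>\<^sub>F t in at t0 within {a..b}. (u t \<noteq> 0 \<or> v t \<noteq> 0) \<and> p * v t = q * u t"
proof -
  have "\<forall>\<^sub>F t in at t0 within {a..b}. u t \<noteq> 0 \<or> v t \<noteq> 0"
    using pq
  proof
    assume "p \<noteq> 0"
    then show ?thesis using tendsto_imp_eventually_ne[OF p, of 0] by (auto elim: eventually_mono)
  next
    assume "q \<noteq> 0"
    then show ?thesis using tendsto_imp_eventually_ne[OF q, of 0] by (auto elim: eventually_mono)
  qed
  then obtain e where e: "e > 0"
    and nz: "\<And>t. t \<in> {a..b} \<Longrightarrow> t \<noteq> t0 \<Longrightarrow> \<bar>t - t0\<bar> < e \<Longrightarrow> u t \<noteq> 0 \<or> v t \<noteq> 0"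
    by (auto simp: eventually_at dist_real_def)
  have side: "p * v t = q * u t"
    if J: "convex J" "J \<subseteq> {a..b}" "\<And>x. x \<in> J \<Longrightarrow> x \<noteq> t0 \<and> \<bar>x - t0\<bar> < e"
      and t: "t \<in> J" and nb: "at t0 within J \<noteq> bot" for J t
  proof -
    have par: "u s * v t = v s * u t" if "s \<in> J" for s
      by (rule wronskian_zero_imp_parallel[where J = J and u = u and v = v and u' = u' and v' = v'])
         (use J nz W t that in \<open>auto intro: DERIV_subset[OF u] DERIV_subset[OF v]\<close>)
    have "((\<lambda>s. u s / (s - t0) ^ k * v t - v s / (s - t0) ^ k * u t) \<longlongrightarrow> p * v t - q * u t)
        (at t0 within J)"
      by (intro tendsto_intros tendsto_within_subset[OF p] tendsto_within_subset[OF q] J)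
    moreover have "\<forall>\<^sub>F s in at t0 within J. u s / (s - t0) ^ k * v t - v s / (s - t0) ^ k * u t = 0"
      using par by (auto simp: eventually_at_filter)
    ultimately have "((\<lambda>s. 0) \<longlongrightarrow> p * v t - q * u t) (at t0 within J)"
      using tendsto_cong by fast
    then show ?thesis using nb by (simp add: tendsto_const_iff)
  qed
  have "p * v t = q * u t" if t: "t \<in> {a..b}" "t \<noteq> t0" "\<bar>t - t0\<bar> < e" for t
  proof (cases "t0 < t")
    case True
    show ?thesis
      by (rule side[of "{t0<..t}"]) (use True t t0 in \<open>auto simp: trivial_limit_within\<close>)
  next
    case False
    show ?thesis
      by (rule side[of "{t..<t0}"]) (use False t t0 in \<open>auto simp: trivial_limit_within\<close>)
  qed
  then show ?thesis
    using e nz by (auto simp: eventually_at dist_real_def)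
qed

text \<open>Common zeros in \<open>S\<close> have finite order. The direction
  \<open>(p, q)\<close> found near one point of \<open>S\<close> spreads over all of \<open>S\<close>: the statement that
  \<open>(u, v)\<close> is parallel to \<open>(p, q)\<close> on a punctured neighbourhood of \<open>t\<close> is locally constant in \<open>t\<close>.
  Punctured neighbourhoods are used because \<open>(u, v)\<close> may vanish at \<open>t\<close> itself.\<close>

lemma wronskian_zero_imp_dependent:
  fixes u v u' v' :: "real \<Rightarrow> real"
  assumes ab: "a < b"
    and u: "\<And>x. x \<in> {a..b} \<Longrightarrow> (u has_field_derivative u' x) (at x within {a..b})"
    and v: "\<And>x. x \<in> {a..b} \<Longrightarrow> (v has_field_derivative v' x) (at x within {a..b})"
    and W: "\<And>x. x \<in> {a..b} \<Longrightarrow> u x * v' x = u' x * v x"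
    and S: "connected S" "S \<subseteq> {a..b}"
    and out: "\<And>t. t \<in> {a..b} - S \<Longrightarrow> u t = 0 \<and> v t = 0"
    and order: "\<And>t. t \<in> S \<Longrightarrow> \<exists>k p q. (p \<noteq> 0 \<or> q \<noteq> 0) \<and>
        ((\<lambda>s. u s / (s - t) ^ k) \<longlongrightarrow> p) (at t within {a..b}) \<and>
        ((\<lambda>s. v s / (s - t) ^ k) \<longlongrightarrow> q) (at t within {a..b})"
  shows "\<exists>p q. (p \<noteq> 0 \<or> q \<noteq> 0) \<and> (\<forall>t\<in>{a..b}. p * v t = q * u t)"
proof (cases "S = {}")
  case True
  then show ?thesis using out by (intro exI[of _ 1] exI[of _ 0]) auto
next
  case False
  have dir: "\<exists>p q. (p \<noteq> 0 \<or> q \<noteq> 0) \<and>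
      (\<forall>\<^sub>F s in at t within {a..b}. (u s \<noteq> 0 \<or> v s \<noteq> 0) \<and> p * v s = q * u s)"
    if t: "t \<in> S" for t
    using order[OF t] wronskian_zero_direction_at[OF _ u v W] S(2) t by blast
  from False obtain t1 where t1: "t1 \<in> S" by auto
  from dir[OF t1] obtain p q where pq: "p \<noteq> 0 \<or> q \<noteq> 0"
    and "\<forall>\<^sub>F s in at t1 within {a..b}. (u s \<noteq> 0 \<or> v s \<noteq> 0) \<and> p * v s = q * u s"
    by blast
  then have start: "\<forall>\<^sub>F s in at t1 within {a..b}. p * v s = q * u s"
    by (auto elim: eventually_mono)
  have nb: "at t within {a..b} \<noteq> bot" if "t \<in> {a..b}" for t
    using that ab by (simp add: trivial_limit_within)
  have ev: "\<forall>\<^sub>F s in at t within {a..b}. p * v s = q * u s" if "t \<in> S" for t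
  proof (rule connected_induction_simple[OF S(1) t1 that, of "\<lambda>t. \<forall>\<^sub>F s in at t within {a..b}. p * v s = q * u s"])
    fix t assume t: "t \<in> S"
    obtain p' q' e where pq': "p' \<noteq> 0 \<or> q' \<noteq> 0" and e: "e > 0"
      and near: "\<And>s. s \<in> {a..b} \<Longrightarrow> s \<noteq> t \<Longrightarrow> \<bar>s - t\<bar> < e \<Longrightarrow>
          (u s \<noteq> 0 \<or> v s \<noteq> 0) \<and> p' * v s = q' * u s"
      using dir[OF t] unfolding eventually_at dist_real_def by blast
    have step: "\<forall>\<^sub>F s in at y within {a..b}. p * v s = q * u s"
      if x: "x \<in> S \<inter> ball t e" and y: "y \<in> S \<inter> ball t e"
        and Px: "\<forall>\<^sub>F s in at x within {a..b}. p * v s = q * u s" for x y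
    proof -
      have punct: "\<forall>\<^sub>F s in at r within {a..b}. s \<in> {a..b} \<and> s \<noteq> t \<and> \<bar>s - t\<bar> < e"
        if r: "r \<in> S \<inter> ball t e" for r
      proof -
        have "\<forall>\<^sub>F s in at r within {a..b}. s \<in> ball t e"
          using r by (intro topological_tendstoD[OF tendsto_ident_at]) auto
        moreover have "\<forall>\<^sub>F s in at r within {a..b}. s \<in> {a..b}"
          by (simp add: eventually_at_filter)
        moreover have "\<forall>\<^sub>F s in at r within {a..b}. s \<noteq> t"
        proof (cases "r = t")
          case False
          then show ?thesis by (intro tendsto_imp_eventually_ne[OF tendsto_ident_at])
        qed (simp add: eventually_at_filter)
        ultimately show ?thesis
          by eventually_elim (auto simp: dist_real_def abs_minus_commute)
      qed
      \<comment> \<open>At a nearby point other than \<open>t\<close> the vector \<open>(u, v)\<close> is nonzero and parallel to both directions.\<close>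
      have "\<exists>s. p * v s = q * u s \<and> s \<in> {a..b} \<and> s \<noteq> t \<and> \<bar>s - t\<bar> < e"
        using eventually_happens[OF eventually_conj[OF Px punct[OF x]]] nb[of x] x S(2) by auto
      then obtain s where s: "p * v s = q * u s" "u s \<noteq> 0 \<or> v s \<noteq> 0" "p' * v s = q' * u s"
        using near by blast
      have 1: "(p * q' - p' * q) * u s = 0" "(p * q' - p' * q) * v s = 0"
        using s(1,3) by algebra+
      then have *: "p * q' = p' * q" using s(2) by auto
      have "p * v r = q * u r" if r: "r \<in> {a..b}" "r \<noteq> t" "\<bar>r - t\<bar> < e" for r
      proof -
        have "p' * (p * v r - q * u r) = 0" "q' * (p * v r - q * u r) = 0"
          using near[OF r] * by algebra+
        then show ?thesis using pq' by auto
      qed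
      then show ?thesis using punct[OF y] by (auto elim: eventually_mono)
    qed
    have op: "openin (top_of_set S) (S \<inter> ball t e)" by (auto simp: openin_open)
    show "\<exists>U. openin (top_of_set S) U \<and> t \<in> U \<and> (\<forall>x\<in>U. \<forall>y\<in>U.
        (\<forall>\<^sub>F s in at x within {a..b}. p * v s = q * u s) \<longrightarrow>
        (\<forall>\<^sub>F s in at y within {a..b}. p * v s = q * u s))"
    proof (intro exI[of _ "S \<inter> ball t e"] conjI ballI impI)
      show "t \<in> S \<inter> ball t e" using t e by simp
    qed (fact op, rule step)
  qed (rule start)
  have "p * v t = q * u t" if t: "t \<in> {a..b}" for t
  proof (cases "t \<in> S")
    case True
    have "((\<lambda>s. p * v s - q * u s) \<longlongrightarrow> p * v t - q * u t) (at t within {a..b})"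
      using DERIV_continuous[OF u[OF t]] DERIV_continuous[OF v[OF t]]
      unfolding continuous_within by (intro tendsto_intros)
    moreover have "\<forall>\<^sub>F s in at t within {a..b}. p * v s - q * u s = 0"
      using ev[OF True] by (auto elim: eventually_mono)
    ultimately have "((\<lambda>s. 0) \<longlongrightarrow> p * v t - q * u t) (at t within {a..b})"
      using tendsto_cong by fast
    then show ?thesis using nb[OF t] by (simp add: tendsto_const_iff)
  next
    case False
    then show ?thesis using out t by auto
  qed
  then show ?thesis using pq by blast
qed

section \<open>The bracket\<close>

lemma bounded_bilinear_bracket: "bounded_bilinear bracket"
  unfolding bilinear_conv_bounded_bilinear[symmetric]
  by (simp add: bilinear_def linear_iff bracket_eq algebra_simps)

lemma bracket_simps:
  "bracket a a = 0" "bracket a 0 = 0" "bracket a (x + y) = bracket a x + bracket a y"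
  "bracket a (r *\<^sub>R x) = r * bracket a x" "bracket (x - y) a = bracket x a - bracket y a"
  by (simp_all add: bracket_eq algebra_simps)

lemma bracket_antisym: "bracket a b = - bracket b a"
  by (simp add: bracket_eq)

lemma lin_indep_pair_imp_bracket_nonzero:
  assumes "lin_indep_pair a b"
  shows "bracket b a \<noteq> 0"
proof
  assume br: "bracket b a = 0"
  have ab: "a \<noteq> b" "a \<notin> span {b}" "b \<noteq> 0"
    using assms by (auto simp: lin_indep_pair_def independent_insert)
  from ab(3) have "b $ 1 \<noteq> 0 \<or> b $ 2 \<noteq> 0"
    by (auto simp: vec_eq_iff forall_2)
  then have "\<exists>r. a = r *\<^sub>R b"
  proof
    assume "b $ 1 \<noteq> 0"
    then show ?thesis using br
      by (intro exI[of _ "a $ 1 / b $ 1"]) (auto simp: vec_eq_iff forall_2 bracket_eq field_simps)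
  next
    assume "b $ 2 \<noteq> 0"
    then show ?thesis using br
      by (intro exI[of _ "a $ 2 / b $ 2"]) (auto simp: vec_eq_iff forall_2 bracket_eq field_simps)
  qed
  then show False using ab(2) by (auto simp: span_singleton)
qed

lemma bracket_eq_0_imp_zero:
  assumes "bracket a b \<noteq> 0" "bracket a x = 0" "bracket b x = 0"
  shows "x = 0"
proof -
  have "bracket a b * x $ 1 = a $ 1 * bracket x b + b $ 1 * bracket a x"
    "bracket a b * x $ 2 = a $ 2 * bracket x b + b $ 2 * bracket a x"
    by (simp_all add: bracket_eq algebra_simps)
  then show ?thesis
    using assms bracket_antisym[of x b] by (simp add: vec_eq_iff forall_2)
qed

section \<open>Self-stresses of a one-strip framework\<close>

locale one_strip =
  fixes T :: real and f :: "nat \<Rightarrow> real \<Rightarrow> real^2"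
  assumes T_pos: "T > 0" and framework: "one_strip_framework T f"
begin

abbreviation d :: "nat \<Rightarrow> nat \<Rightarrow> real \<Rightarrow> real^2" where
  "d k i t \<equiv> nderiv {0..T} k (f i) t"

abbreviation \<Delta> :: "real \<Rightarrow> real^2" where "\<Delta> \<equiv> strip_diff f"

definition \<alpha> :: "nat \<Rightarrow> real \<Rightarrow> real" where "\<alpha> i t = bracket (\<Delta> t) (d 1 i t)"
definition c :: "nat \<Rightarrow> real \<Rightarrow> real" where "c i t = bracket (\<Delta> t) (d 2 i t)"
definition w :: "real \<Rightarrow> real" where "w t = bracket (d 1 0 t) (d 1 1 t)"

abbreviation g :: "nat \<Rightarrow> real \<Rightarrow> real" where "g i \<equiv> inflection T (f i)"

text \<open>The positive solution, normalised at \<open>0\<close>, of the equation \<open>y' \<alpha>\<^sub>i + y c\<^sub>i = 0\<close> for the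
  stress coefficient of the \<open>i\<close>-th curve.\<close>

definition E :: "nat \<Rightarrow> real \<Rightarrow> real" where
  "E i t = exp (- integral {0..t} (\<lambda>s. c i s / \<alpha> i s))"

text \<open>The value that the stress equation of the \<open>i\<close>-th curve forces on the coefficient of \<open>\<Delta>\<close> when
  \<open>E i\<close> is the coefficient along the curve.\<close>

definition u :: "nat \<Rightarrow> real \<Rightarrow> real" where "u i t = E i t * g i t / \<alpha> i t"

text \<open>The derivative of \<open>u i\<close>, simplified by \<open>E\<^sub>i' = - (c\<^sub>i / \<alpha>\<^sub>i) E\<^sub>i\<close> and \<open>\<alpha>\<^sub>i' = c\<^sub>i - w\<close>.\<close>

definition u' :: "nat \<Rightarrow> real \<Rightarrow> real" where
  "u' i t = E i t / \<alpha> i t ^ 2 *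
     (\<alpha> i t * bracket (d 1 i t) (d 3 i t) - g i t * (2 * c i t - w t))"

context
  fixes i :: nat
  assumes i: "i \<in> {0, 1}"
begin

lemma smooth_curve: "smooth_on {0..T} (f i)"
  using framework i by (auto simp: one_strip_framework_def)

lemma \<alpha>_nonzero: "t \<in> {0..T} \<Longrightarrow> \<alpha> i t \<noteq> 0"
  using framework i lin_indep_pair_imp_bracket_nonzero
  by (auto simp: one_strip_framework_def \<alpha>_def)

lemma d_deriv: "t \<in> {0..T} \<Longrightarrow> (d k i has_vector_derivative d (Suc k) i t) (at t within {0..T})"
  using smooth_on_nderiv_deriv[OF smooth_curve] .

lemma smooth_inflection: "smooth_on {0..T} (g i)"
  unfolding inflection_def
  by (intro smooth_on_bilinear[OF bounded_bilinear_bracket T_pos] smooth_on_nderiv_smooth smooth_curve)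

lemma inflection_deriv:
  assumes "t \<in> {0..T}"
  shows "(g i has_real_derivative bracket (d 1 i t) (d 3 i t)) (at t within {0..T})"
  unfolding has_real_derivative_iff_has_vector_derivative inflection_def
  using bounded_bilinear.has_vector_derivative[OF bounded_bilinear_bracket
      d_deriv[OF assms, of 1] d_deriv[OF assms, of 2]]
  by (simp add: bracket_simps numeral_2_eq_2 numeral_3_eq_3)

end

lemma \<Delta>_deriv:
  assumes "t \<in> {0..T}"
  shows "(\<Delta> has_vector_derivative d 1 1 t - d 1 0 t) (at t within {0..T})"
proof -
  have "((\<lambda>t. f 1 t - f 0 t) has_vector_derivative d 1 1 t - d 1 0 t) (at t within {0..T})"
    using d_deriv[of 0 t 0] d_deriv[of 1 t 0] assms
    by (intro has_vector_derivative_diff) auto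
  then show ?thesis by (simp add: strip_diff_def[abs_def])
qed

context
  fixes i :: nat
  assumes i: "i \<in> {0, 1}"
begin

text \<open>The same function \<open>w\<close> appears for both curves, as
  \<open>[f\<^sub>1' - f\<^sub>0', f\<^sub>0'] = [f\<^sub>1', f\<^sub>0'] = - [f\<^sub>0', f\<^sub>1'] = [f\<^sub>1' - f\<^sub>0', f\<^sub>1']\<close>.\<close>

lemma \<alpha>_deriv:
  assumes "t \<in> {0..T}"
  shows "(\<alpha> i has_real_derivative c i t - w t) (at t within {0..T})"
proof -
  have "bracket (d 1 1 t - d 1 0 t) (d 1 i t) = - w t"
    using i by (auto simp: bracket_simps w_def bracket_antisym[of "d (Suc 0) (Suc 0) t" "d (Suc 0) 0 t"])
  then show ?thesis
    unfolding has_real_derivative_iff_has_vector_derivative \<alpha>_def[abs_def]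
    using bounded_bilinear.has_vector_derivative[OF bounded_bilinear_bracket
        \<Delta>_deriv[OF assms] d_deriv[OF i assms, of 1]]
    by (simp add: c_def numeral_2_eq_2)
qed

lemma \<alpha>_continuous: "continuous_on {0..T} (\<alpha> i)"
  using \<alpha>_deriv DERIV_continuous continuous_on_eq_continuous_within by blast

lemma c_continuous: "continuous_on {0..T} (c i)"
  unfolding c_def[abs_def]
  by (intro bounded_bilinear.continuous_on[OF bounded_bilinear_bracket]
      smooth_on_nderiv_continuous smooth_curve i)
     (meson \<Delta>_deriv has_vector_derivative_continuous continuous_on_eq_continuous_within)

lemma E_pos: "E i t > 0"
  by (simp add: E_def)

lemma E_deriv:
  assumes "t \<in> {0..T}"
  shows "(E i has_real_derivative - (c i t / \<alpha> i t) * E i t) (at t within {0..T})"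
proof -
  have "continuous_on {0..T} (\<lambda>s. c i s / \<alpha> i s)"
    by (intro continuous_on_divide c_continuous \<alpha>_continuous) (use \<alpha>_nonzero[OF i] in blast)
  then have "((\<lambda>t. integral {0..t} (\<lambda>s. c i s / \<alpha> i s)) has_real_derivative c i t / \<alpha> i t)
      (at t within {0..T})"
    by (rule integral_has_real_derivative[OF _ assms])
  then show ?thesis
    unfolding E_def[abs_def] by (auto intro!: derivative_eq_intros)
qed

lemma E_continuous: "continuous_on {0..T} (E i)"
  using E_deriv DERIV_continuous continuous_on_eq_continuous_within by blast

lemma u_deriv:
  assumes "t \<in> {0..T}"
  shows "(u i has_real_derivative u' i t) (at t within {0..T})"
  unfolding u_def[abs_def]
  by (rule DERIV_cong[OF DERIV_divide[OF DERIV_mult[OF E_deriv[OF assms]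
          inflection_deriv[OF i assms]] \<alpha>_deriv[OF assms] \<alpha>_nonzero[OF i assms]]])
     (use \<alpha>_nonzero[OF i assms] in \<open>simp add: u'_def field_simps power2_eq_square\<close>)

text \<open>Solutions form a one-dimensional space: the quotient of a solution by \<open>E i\<close> has derivative
  zero.\<close>

lemma stress_solution:
  assumes l: "\<And>t. t \<in> {0..T} \<Longrightarrow> (l has_real_derivative l' t) (at t within {0..T})"
    and ode: "\<And>t. t \<in> {0..T} \<Longrightarrow> l' t * \<alpha> i t + l t * c i t = 0"
  shows "\<exists>C. \<forall>t\<in>{0..T}. l t = C * E i t"
proof -
  have "((\<lambda>t. l t / E i t) has_real_derivative 0) (at t within {0..T})" if t: "t \<in> {0..T}" for t
  proof -
    have l': "l' t = - (c i t / \<alpha> i t) * l t"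
      using ode[OF t] \<alpha>_nonzero[OF i t] by (simp add: field_simps)
    show ?thesis
      using DERIV_divide[OF l[OF t] E_deriv[OF t]] E_pos[of t] by (simp add: l')
  qed
  then obtain C where "\<And>t. t \<in> {0..T} \<Longrightarrow> l t / E i t = C"
    using has_field_derivative_zero_constant[of "{0..T}" "\<lambda>t. l t / E i t"] by auto
  then have "l t = C * E i t" if "t \<in> {0..T}" for t
    using E_pos[of t] that by (force simp: field_simps)
  then show ?thesis by blast
qed

lemma multiple_of_E:
  defines "l \<equiv> \<lambda>C t. C * E i t"
  shows "C1_on {0..T} (l C)"
    and "t \<in> {0..T} \<Longrightarrow> nderiv {0..T} 1 (l C) t * \<alpha> i t + l C t * c i t = 0"
proof -
  have D: "(l C has_vector_derivative C * (- (c i t / \<alpha> i t) * E i t)) (at t within {0..T})"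
    if "t \<in> {0..T}" for t
    unfolding has_real_derivative_iff_has_vector_derivative[symmetric] l_def
    by (rule DERIV_cmult[OF E_deriv[OF that]])
  have nd: "nderiv {0..T} 1 (l C) t = C * (- (c i t / \<alpha> i t) * E i t)" if "t \<in> {0..T}" for t
    by (rule nderiv_1_eqI[OF T_pos that D[OF that]])
  have "continuous_on {0..T} (\<lambda>t. C * (- (c i t / \<alpha> i t) * E i t))"
    by (intro continuous_intros c_continuous \<alpha>_continuous E_continuous)
       (use \<alpha>_nonzero[OF i] in blast)
  then have "continuous_on {0..T} (nderiv {0..T} 1 (l C))"
    by (rule continuous_on_eq) (use nd in simp)
  then show "C1_on {0..T} (l C)"
    unfolding C1_on_def using differentiableI_vector[OF D] by blast
  show "nderiv {0..T} 1 (l C) t * \<alpha> i t + l C t * c i t = 0" if "t \<in> {0..T}"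
    using \<alpha>_nonzero[OF i that] by (subst nd[OF that]) (simp add: l_def)
qed

text \<open>A vector of the plane is zero iff its brackets with the basis \<open>\<Delta>\<close>, \<open>f\<^sub>i'\<close> are; the first bracket
  removes \<open>m\<close>, the second removes \<open>l'\<close>.\<close>

lemma stress_equation_iff:
  assumes "t \<in> {0..T}"
  shows "l' *\<^sub>R d 1 i t + l *\<^sub>R d 2 i t + m *\<^sub>R \<Delta> t = 0 \<longleftrightarrow>
    l' * \<alpha> i t + l * c i t = 0 \<and> l * g i t = m * \<alpha> i t"
    (is "?x = 0 \<longleftrightarrow> _")
proof -
  have 1: "bracket (\<Delta> t) ?x = l' * \<alpha> i t + l * c i t"
    by (simp add: bracket_simps \<alpha>_def c_def)
  have 2: "bracket (d 1 i t) ?x = l * g i t - m * \<alpha> i t"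
    using bracket_antisym[of "d 1 i t" "\<Delta> t"]
    by (simp add: bracket_simps \<alpha>_def inflection_def)
  have "x = 0 \<longleftrightarrow> bracket (\<Delta> t) x = 0 \<and> bracket (d 1 i t) x = 0" for x
    using bracket_eq_0_imp_zero[of "\<Delta> t" "d 1 i t" x] \<alpha>_nonzero[OF i assms]
    by (auto simp: \<alpha>_def bracket_simps)
  from this[of ?x] show ?thesis unfolding 1 2 by simp
qed

lemma u_leading_term:
  assumes t: "t \<in> {0..T}" and low: "\<And>j. j < k \<Longrightarrow> nderiv {0..T} j (g i) t = 0"
  shows "((\<lambda>s. u i s / (s - t) ^ k) \<longlongrightarrow> E i t / \<alpha> i t * (nderiv {0..T} k (g i) t / fact k))
    (at t within {0..T})"
proof -
  have "((\<lambda>s. E i s / \<alpha> i s) \<longlongrightarrow> E i t / \<alpha> i t) (at t within {0..T})"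
    using E_continuous \<alpha>_continuous \<alpha>_nonzero[OF i t] t
    by (intro tendsto_divide) (auto simp: continuous_on_def)
  from tendsto_mult[OF this taylor_leading_term[OF smooth_inflection[OF i] t low]]
  show ?thesis by (simp add: u_def)
qed

end

text \<open>A self-stress is \<open>\<lambda>\<^sub>0 = - q E\<^sub>0\<close>, \<open>\<lambda>\<^sub>1 = p E\<^sub>1\<close>, \<open>\<mu>\<^sub>0 = - q u\<^sub>0 = - p u\<^sub>1\<close>. If both constants are
  zero then so is \<open>\<mu>\<^sub>0\<close>; hence a nonzero stress corresponds exactly to a nontrivial relation.\<close>

lemma liftable_iff_dependent:
  "liftable T f \<longleftrightarrow> (\<exists>p q. (p \<noteq> 0 \<or> q \<noteq> 0) \<and> (\<forall>t\<in>{0..T}. p * u 1 t = q * u 0 t))"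
proof
  assume "liftable T f"
  then obtain l0 l1 m where C1: "C1_on {0..T} l0" "C1_on {0..T} l1"
    and nz: "\<exists>t\<in>{0..T}. l0 t \<noteq> 0 \<or> l1 t \<noteq> 0 \<or> m t \<noteq> 0"
    and eq: "\<forall>t\<in>{0..T}.
      nderiv {0..T} 1 l0 t *\<^sub>R d 1 0 t + l0 t *\<^sub>R d 2 0 t + m t *\<^sub>R \<Delta> t = 0 \<and>
      nderiv {0..T} 1 l1 t *\<^sub>R d 1 1 t + l1 t *\<^sub>R d 2 1 t - m t *\<^sub>R \<Delta> t = 0"
    unfolding liftable_def by (elim exE conjE) (rule that)
  have D: "(l has_real_derivative nderiv {0..T} 1 l t) (at t within {0..T})"
    if "C1_on {0..T} l" "t \<in> {0..T}" for l t
    using that by (simp add: C1_on_def nderiv_Suc vector_derivative_works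
        has_real_derivative_iff_has_vector_derivative)
  have s0: "nderiv {0..T} 1 l0 t * \<alpha> 0 t + l0 t * c 0 t = 0" "l0 t * g 0 t = m t * \<alpha> 0 t"
    if "t \<in> {0..T}" for t
    using bspec[OF eq that] stress_equation_iff[OF _ that, of 0] by auto
  have s1: "nderiv {0..T} 1 l1 t * \<alpha> 1 t + l1 t * c 1 t = 0" "l1 t * g 1 t = - m t * \<alpha> 1 t"
    if "t \<in> {0..T}" for t
    using bspec[OF eq that] stress_equation_iff[OF _ that, of 1 _ _ "- m t"] by auto
  obtain C0 where C0: "\<And>t. t \<in> {0..T} \<Longrightarrow> l0 t = C0 * E 0 t"
    using stress_solution[of 0 l0, OF _ D[OF C1(1)] s0(1)] by blast
  obtain C1 where C1: "\<And>t. t \<in> {0..T} \<Longrightarrow> l1 t = C1 * E 1 t"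
    using stress_solution[of 1 l1, OF _ D[OF C1(2)] s1(1)] by blast
  have m: "m t = C0 * u 0 t" "- m t = C1 * u 1 t" if t: "t \<in> {0..T}" for t
    using s0(2)[OF t] s1(2)[OF t] C0[OF t] C1[OF t] \<alpha>_nonzero[OF _ t, of 0] \<alpha>_nonzero[OF _ t, of 1]
    by (simp_all add: u_def field_simps)
  have "C1 \<noteq> 0 \<or> - C0 \<noteq> 0"
    using nz m C0 C1 by auto
  moreover have "\<forall>t\<in>{0..T}. C1 * u 1 t = - C0 * u 0 t"
    using m by fastforce
  ultimately show "\<exists>p q. (p \<noteq> 0 \<or> q \<noteq> 0) \<and> (\<forall>t\<in>{0..T}. p * u 1 t = q * u 0 t)"
    by blast
next
  assume "\<exists>p q. (p \<noteq> 0 \<or> q \<noteq> 0) \<and> (\<forall>t\<in>{0..T}. p * u 1 t = q * u 0 t)"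
  then obtain p q where pq: "p \<noteq> 0 \<or> q \<noteq> 0"
    and dep: "\<And>t. t \<in> {0..T} \<Longrightarrow> p * u 1 t = q * u 0 t" by blast
  define l0 where "l0 = (\<lambda>t. - q * E 0 t)"
  define l1 where "l1 = (\<lambda>t. p * E 1 t)"
  define m where "m = (\<lambda>t. - q * u 0 t)"
  have "C1_on {0..T} l0" "C1_on {0..T} l1"
    unfolding l0_def l1_def by (intro multiple_of_E; simp)+
  moreover have "continuous_on {0..T} m"
    unfolding m_def
    by (intro continuous_intros)
       (meson u_deriv DERIV_continuous continuous_on_eq_continuous_within insertI1)
  moreover have "\<exists>t\<in>{0..T}. l0 t \<noteq> 0 \<or> l1 t \<noteq> 0 \<or> m t \<noteq> 0"
    using pq E_pos[of 0 0] E_pos[of 1 0] T_pos by (intro bexI[of _ 0]) (auto simp: l0_def l1_def)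
  moreover have "nderiv {0..T} 1 l0 t *\<^sub>R d 1 0 t + l0 t *\<^sub>R d 2 0 t + m t *\<^sub>R \<Delta> t = 0 \<and>
      nderiv {0..T} 1 l1 t *\<^sub>R d 1 1 t + l1 t *\<^sub>R d 2 1 t - m t *\<^sub>R \<Delta> t = 0" if t: "t \<in> {0..T}" for t
  proof
    have "nderiv {0..T} 1 l0 t * \<alpha> 0 t + l0 t * c 0 t = 0" "l0 t * g 0 t = m t * \<alpha> 0 t"
      using multiple_of_E(2)[OF _ t, of 0 "- q"] \<alpha>_nonzero[OF _ t, of 0]
      by (simp_all add: l0_def m_def u_def)
    then show "nderiv {0..T} 1 l0 t *\<^sub>R d 1 0 t + l0 t *\<^sub>R d 2 0 t + m t *\<^sub>R \<Delta> t = 0"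
      using stress_equation_iff[OF _ t, of 0] by auto
    have "nderiv {0..T} 1 l1 t * \<alpha> 1 t + l1 t * c 1 t = 0"
      using multiple_of_E(2)[OF _ t, of 1 p] by (simp add: l1_def)
    moreover have "l1 t * g 1 t = (p * u 1 t) * \<alpha> 1 t"
      using \<alpha>_nonzero[OF _ t, of 1] by (simp add: l1_def u_def)
    then have "l1 t * g 1 t = - m t * \<alpha> 1 t"
      unfolding dep[OF t] by (simp add: m_def)
    ultimately have "nderiv {0..T} 1 l1 t *\<^sub>R d 1 1 t + l1 t *\<^sub>R d 2 1 t + (- m t) *\<^sub>R \<Delta> t = 0"
      using stress_equation_iff[OF _ t, of 1 _ _ "- m t"] by blast
    then show "nderiv {0..T} 1 l1 t *\<^sub>R d 1 1 t + l1 t *\<^sub>R d 2 1 t - m t *\<^sub>R \<Delta> t = 0"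
      by simp
  qed
  ultimately show "liftable T f"
    unfolding liftable_def by blast
qed

text \<open>With \<open>u'\<close> inserted, the Wronskian of \<open>u 0\<close> and \<open>u 1\<close> is the difference of the
  right and the left side times \<open>E\<^sub>0 E\<^sub>1 / (\<alpha>\<^sub>0 \<alpha>\<^sub>1)\<^sup>2\<close>; the brackets with third derivatives
  are the derivatives of the \<open>g i\<close>.\<close>

lemma wronskian_zero_iff:
  assumes t: "t \<in> {0..T}"
  shows "u 0 t * u' 1 t = u' 0 t * u 1 t \<longleftrightarrow>
    g 0 t * g 1 t * (\<alpha> 0 t * (2 * c 1 t - w t) - \<alpha> 1 t * (2 * c 0 t - w t))
    = \<alpha> 0 t * \<alpha> 1 t *
      (g 0 t * bracket (d 1 1 t) (d 3 1 t) - g 1 t * bracket (d 1 0 t) (d 3 0 t))"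
    (is "_ \<longleftrightarrow> ?L = ?R")
proof -
  have nz: "\<alpha> 0 t \<noteq> 0" "\<alpha> 1 t \<noteq> 0" "E 0 t \<noteq> 0" "E 1 t \<noteq> 0"
    using \<alpha>_nonzero[OF _ t] E_pos[of 0 t] E_pos[of 1 t] by auto
  define X where "X i = \<alpha> i t * bracket (d 1 i t) (d 3 i t) - g i t * (2 * c i t - w t)" for i
  have u'_X: "u' i t = E i t / \<alpha> i t ^ 2 * X i" for i
    by (simp add: u'_def X_def)
  have "u 0 t * u' 1 t = E 0 t * E 1 t / (\<alpha> 0 t * \<alpha> 1 t) ^ 2 * (\<alpha> 0 t * g 0 t * X 1)"
    "u' 0 t * u 1 t = E 0 t * E 1 t / (\<alpha> 0 t * \<alpha> 1 t) ^ 2 * (\<alpha> 1 t * g 1 t * X 0)"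
    using nz by (simp_all add: u_def u'_X power2_eq_square mult_ac)
  moreover have "\<alpha> 0 t * g 0 t * X 1 - \<alpha> 1 t * g 1 t * X 0 = ?R - ?L"
    unfolding X_def by (simp add: algebra_simps)
  ultimately have W: "u 0 t * u' 1 t - u' 0 t * u 1 t =
      E 0 t * E 1 t / (\<alpha> 0 t * \<alpha> 1 t) ^ 2 * (?R - ?L)"
    by (simp only: right_diff_distrib[symmetric])
  have "u 0 t * u' 1 t - u' 0 t * u 1 t = 0 \<longleftrightarrow> ?R - ?L = 0"
    unfolding W using nz by (simp only: mult_eq_0_iff divide_eq_0_iff power_eq_0_iff) simp
  then show ?thesis by linarith
qed

lemma dependent_imp_wronskian_zero:
  assumes pq: "p \<noteq> 0 \<or> q \<noteq> 0" and dep: "\<And>t. t \<in> {0..T} \<Longrightarrow> p * u 1 t = q * u 0 t"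
    and t: "t \<in> {0..T}"
  shows "u 0 t * u' 1 t = u' 0 t * u 1 t"
proof -
  have "((\<lambda>s. p * u 1 s) has_vector_derivative p * u' 1 t) (at t within {0..T})"
    using DERIV_cmult[OF u_deriv[OF _ t, of 1]]
    by (simp add: has_real_derivative_iff_has_vector_derivative)
  then have 1: "((\<lambda>s. q * u 0 s) has_vector_derivative p * u' 1 t) (at t within {0..T})"
    by (rule has_vector_derivative_transform[OF t, rotated]) (rule dep[symmetric])
  have 2: "((\<lambda>s. q * u 0 s) has_vector_derivative q * u' 0 t) (at t within {0..T})"
    using DERIV_cmult[OF u_deriv[OF _ t, of 0]]
    by (simp add: has_real_derivative_iff_has_vector_derivative)
  have d: "p * u' 1 t = q * u' 0 t"
    using nderiv_1_eqI[OF T_pos t 1] nderiv_1_eqI[OF T_pos t 2] by simp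
  have "p * (u 0 t * u' 1 t) = u 0 t * (p * u' 1 t)" by simp
  also have "\<dots> = u' 0 t * (q * u 0 t)" unfolding d by simp
  also have "\<dots> = p * (u' 0 t * u 1 t)" unfolding dep[OF t, symmetric] by simp
  finally have p: "p * (u 0 t * u' 1 t) = p * (u' 0 t * u 1 t)" .
  have "q * (u 0 t * u' 1 t) = u' 1 t * (q * u 0 t)" by simp
  also have "\<dots> = u 1 t * (p * u' 1 t)" unfolding dep[OF t, symmetric] by simp
  also have "\<dots> = q * (u' 0 t * u 1 t)" unfolding d by simp
  finally have "q * (u 0 t * u' 1 t) = q * (u' 0 t * u 1 t)" .
  with p show ?thesis using pq by auto
qed

text \<open>The leading terms of \<open>u 0\<close> and \<open>u 1\<close> at \<open>t\<close> are taken at the common order \<open>k\<close>, the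
  least one at which a derivative of either inflection function is nonzero; at least one of the
  two limits is then nonzero. Using the inflection functions here, rather than \<open>u\<close>,
  avoids higher derivatives of \<open>E\<close>.\<close>

lemma wronskian_zero_imp_liftable:
  assumes flat: "flat_inflections_nonseparating T f"
    and W: "\<And>t. t \<in> {0..T} \<Longrightarrow> u 0 t * u' 1 t = u' 0 t * u 1 t"
  shows "liftable T f"
proof -
  let ?S = "{t\<in>{0..T}. \<exists>k. nderiv {0..T} k (g 0) t \<noteq> 0 \<or> nderiv {0..T} k (g 1) t \<noteq> 0}"
  have conn: "connected ?S"
    using flat by (simp add: flat_inflections_nonseparating_def)
  have out: "u 0 t = 0 \<and> u 1 t = 0" if "t \<in> {0..T} - ?S" for t
  proof -
    have "nderiv {0..T} 0 (g 0) t = 0" "nderiv {0..T} 0 (g 1) t = 0"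
      using that by blast+
    then show ?thesis by (simp add: u_def)
  qed
  have order: "\<exists>k p q. (p \<noteq> 0 \<or> q \<noteq> 0) \<and>
      ((\<lambda>s. u 0 s / (s - t) ^ k) \<longlongrightarrow> p) (at t within {0..T}) \<and>
      ((\<lambda>s. u 1 s / (s - t) ^ k) \<longlongrightarrow> q) (at t within {0..T})" if "t \<in> ?S" for t
  proof -
    define P where "P = (\<lambda>k. nderiv {0..T} k (g 0) t \<noteq> 0 \<or> nderiv {0..T} k (g 1) t \<noteq> 0)"
    define k where "k = (LEAST k. P k)"
    have t: "t \<in> {0..T}" and "\<exists>k. P k" using that by (auto simp: P_def)
    then have "P k" unfolding k_def by (metis LeastI)
    have low: "\<not> P j" if "j < k" for j
      using that not_less_Least unfolding k_def by blast
    let ?p = "\<lambda>i. E i t / \<alpha> i t * (nderiv {0..T} k (g i) t / fact k)"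
    have "?p 0 \<noteq> 0 \<or> ?p 1 \<noteq> 0"
      using \<open>P k\<close> \<alpha>_nonzero[OF _ t, of 0] \<alpha>_nonzero[OF _ t, of 1] E_pos[of 0 t] E_pos[of 1 t]
      by (auto simp: P_def)
    moreover have "((\<lambda>s. u i s / (s - t) ^ k) \<longlongrightarrow> ?p i) (at t within {0..T})" if "i \<in> {0, 1}" for i
      by (rule u_leading_term[OF that t]) (use low that in \<open>auto simp: P_def\<close>)
    ultimately show ?thesis by blast
  qed
  show ?thesis
    unfolding liftable_iff_dependent
  proof (rule wronskian_zero_imp_dependent[OF T_pos, where u = "u 0" and v = "u 1"
        and u' = "u' 0" and v' = "u' 1" and S = ?S])
    show "(u 0 has_real_derivative u' 0 t) (at t within {0..T})"
      "(u 1 has_real_derivative u' 1 t) (at t within {0..T})" if "t \<in> {0..T}" for t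
      using that by (intro u_deriv; simp)+
  qed (fact W conn out order | blast)+
qed

end

theorem proposition4p4:
  fixes T :: real and f :: "nat \<Rightarrow> real \<Rightarrow> real^2"
  assumes "T > 0"
    and "one_strip_framework T f"
  shows
    "let d = (\<lambda>k i t. nderiv {0..T} k (f i) t);
         \<Delta> = strip_diff f;
         condition = (\<forall>t\<in>{0..T}.
           bracket (d 1 0 t) (d 2 0 t) * bracket (d 1 1 t) (d 2 1 t) *
             (bracket (\<Delta> t) (d 1 0 t) *
                (2 * bracket (\<Delta> t) (d 2 1 t) - bracket (d 1 0 t) (d 1 1 t))
              - bracket (\<Delta> t) (d 1 1 t) *
                (2 * bracket (\<Delta> t) (d 2 0 t) - bracket (d 1 0 t) (d 1 1 t)))
           = bracket (\<Delta> t) (d 1 0 t) * bracket (\<Delta> t) (d 1 1 t) *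
             (bracket (d 1 0 t) (d 2 0 t) * bracket (d 1 1 t) (d 3 1 t)
              - bracket (d 1 1 t) (d 2 1 t) * bracket (d 1 0 t) (d 3 0 t)))
     in (liftable T f \<longrightarrow> condition) \<and>
        (flat_inflections_nonseparating T f \<longrightarrow> (liftable T f \<longleftrightarrow> condition))"
proof -
  interpret one_strip T f
    using assms by unfold_locales
  let ?W = "\<forall>t\<in>{0..T}. u 0 t * u' 1 t = u' 0 t * u 1 t"
  have "liftable T f \<longrightarrow> ?W"
    unfolding liftable_iff_dependent using dependent_imp_wronskian_zero by blast
  moreover have "flat_inflections_nonseparating T f \<longrightarrow> ?W \<longrightarrow> liftable T f"
    using wronskian_zero_imp_liftable by blast
  ultimately have "(liftable T f \<longrightarrow> ?W) \<and>
      (flat_inflections_nonseparating T f \<longrightarrow> (liftable T f \<longleftrightarrow> ?W))"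
    by blast
  moreover have "?W \<longleftrightarrow> (\<forall>t\<in>{0..T}.
      bracket (d 1 0 t) (d 2 0 t) * bracket (d 1 1 t) (d 2 1 t) *
        (bracket (\<Delta> t) (d 1 0 t) *
           (2 * bracket (\<Delta> t) (d 2 1 t) - bracket (d 1 0 t) (d 1 1 t))
         - bracket (\<Delta> t) (d 1 1 t) *
           (2 * bracket (\<Delta> t) (d 2 0 t) - bracket (d 1 0 t) (d 1 1 t)))
      = bracket (\<Delta> t) (d 1 0 t) * bracket (\<Delta> t) (d 1 1 t) *
        (bracket (d 1 0 t) (d 2 0 t) * bracket (d 1 1 t) (d 3 1 t)
         - bracket (d 1 1 t) (d 2 1 t) * bracket (d 1 0 t) (d 3 0 t)))"
    by (intro ball_cong refl wronskian_zero_iff[unfolded \<alpha>_def c_def w_def inflection_def])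
  ultimately show ?thesis
    unfolding Let_def by argo
qed

end
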